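(* Let $X$ and $Y$ be Banach spaces, and let $1\leq p\leq\infty$, $0\leq C\leq\infty$, and $1\leq\xi<\omega_1$. Then $\mathcal{V}(X,Y)\subseteq\mathcal{WD}_{\ell_p}^{(C,\xi)}(X,Y)$.
   Context: All Banach spaces are over a fixed scalar field ($\mathbb{R}$ or $\mathbb{C}$); $\mathcal{L}(X,Y)$ is the space of continuous linear operators $X\to Y$; $c_{00}$ is the space of finitely supported scalar sequences; $\omega_1$ is the first uncountable ordinal. $\mathcal{V}(X,Y)$ is the space of completely continuous operators $X\to Y$, i.e. those in $\mathcal{L}(X,Y)$ sending every weakly null sequence to a norm-null sequence. For finite $E,F\subset\mathbb{N}$, $E<F$ means $\max E<\min F$, and $n\leq F$ means $n\leq\min F$. Schreier families: $\mathcal{S}_0:=\{\{n\}:n\in\mathbb{N}\}\cup\{\emptyset\}$ and $\mathcal{S}_1:=\{F\subset\mathbb{N}:\#F\leq\min F\}\cup\{\emptyset\}$. If $\xi=\zeta+1$ with $1\leq\zeta<\omega_1$, $\mathcal{S}_\xi$ consists of $\emptyset$ and all $F\subset\mathbb{N}$ for which there are $n\in\mathbb{N}$ and $F_1<\cdots<F_n$ in $\mathcal{S}_\zeta$ with $\{\min F_k\}_{k=1}^n\in\mathcal{S}_1$ and $F=\bigcup_{k=1}^nF_k$. If $\xi<\omega_1$ is a limit ordinal, fix a strictly increasing sequence $(\zeta_n)$ of non-limit ordinals with $\sup_n\zeta_n=\xi$ and set $\mathcal{S}_\xi:=\bigcup_{n=1}^\infty\{F\in\mathcal{S}_{\zeta_n}:n\leq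 F\}$. Put $\mathcal{A}_\xi:=\{(\alpha_k)\in c_{00}:\mathrm{supp}(\alpha_k)\in\mathcal{S}_\xi\}$. For $1\leq p\leq\infty$ and $0\leq C<\infty$, $\mathcal{WD}_{\ell_p}^{(C,\xi)}(X,Y)$ is the set of all $T\in\mathcal{L}(X,Y)$ such that for every $\epsilon>0$, each normalized weakly null sequence $(x_n)\subset X$ admits a subsequence $(x_{n_k})$ with $\|\sum\alpha_kTx_{n_k}\|\leq(C+\epsilon)\|(\alpha_k)\|_{\ell_p}$ for all $(\alpha_k)\in\mathcal{A}_\xi$. Set $\mathcal{WD}_{\ell_p}^{(\infty,\xi)}(X,Y):=\bigcup_{0\leq C<\infty}\mathcal{WD}_{\ell_p}^{(C,\xi)}(X,Y)$. *)

theory Defs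
  imports "HOL-Analysis.Analysis"
begin

section \<open>Countable ordinals\<close>

text \<open>
  The cardinal successor of \<open>natLeq\<close> is a well-order of type \<open>\<omega>\<^sub>1\<close>; its elements, in that order,
  are used as the ordinals below \<open>\<omega>\<^sub>1\<close>.
\<close>

lemma Card_order_cardSuc_natLeq: "Card_order (cardSuc natLeq)"
  by (rule cardSuc_Card_order[OF natLeq_Card_order])

lemma infinite_Field_cardSuc_natLeq: "infinite (Field (cardSuc natLeq))"
  using cardSuc_finite[OF natLeq_Card_order] by (simp add: Field_natLeq)

typedef omega1 = "Field (cardSuc natLeq)"
  using infinite_Field_cardSuc_natLeq by (metis ex_in_conv finite.emptyI)

instantiation omega1 :: wellorder
begin

definition less_eq_omega1 :: "omega1 \<Rightarrow> omega1 \<Rightarrow> bool" where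
  "\<xi> \<le> \<eta> \<longleftrightarrow> (Rep_omega1 \<xi>, Rep_omega1 \<eta>) \<in> cardSuc natLeq"

definition less_omega1 :: "omega1 \<Rightarrow> omega1 \<Rightarrow> bool" where
  "\<xi> < (\<eta> :: omega1) \<longleftrightarrow> \<xi> \<le> \<eta> \<and> \<xi> \<noteq> \<eta>"

instance
proof -
  have wo: "Well_order (cardSuc natLeq)"
    using Card_order_cardSuc_natLeq by (simp add: card_order_on_def)
  have lo: "Refl (cardSuc natLeq)" "trans (cardSuc natLeq)" "antisym (cardSuc natLeq)"
    "Total (cardSuc natLeq)" and wf: "wf (cardSuc natLeq - Id)"
    using wo by (auto simp: order_on_defs well_order_on_def)
  have refl: "\<xi> \<le> \<xi>" for \<xi> :: omega1
    using lo(1) Rep_omega1[of \<xi>] by (auto simp: less_eq_omega1_def refl_on_def)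
  have asym: "\<xi> = \<eta>" if "\<xi> \<le> \<eta>" "\<eta> \<le> \<xi>" for \<xi> \<eta> :: omega1
    using that lo(3) by (auto simp: less_eq_omega1_def Rep_omega1_inject dest: antisymD)
  have total: "\<xi> \<le> \<eta> \<or> \<eta> \<le> \<xi>" for \<xi> \<eta> :: omega1
    using lo(4) refl[of \<xi>] Rep_omega1[of \<xi>] Rep_omega1[of \<eta>]
    by (cases "\<xi> = \<eta>") (auto simp: less_eq_omega1_def total_on_def Rep_omega1_inject)
  have trans: "\<xi> \<le> \<zeta>" if "\<xi> \<le> \<eta>" "\<eta> \<le> \<zeta>" for \<xi> \<eta> \<zeta> :: omega1
    using that lo(2) by (auto simp: less_eq_omega1_def dest: transD)
  have ind: "P \<xi>" if "\<And>\<eta>. (\<And>\<zeta>. \<zeta> < \<eta> \<Longrightarrow> P \<zeta>) \<Longrightarrow> P \<eta>" for P and \<xi> :: omega1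
  proof -
    have "wf (inv_image (cardSuc natLeq - Id) Rep_omega1)"
      using wf by (rule wf_inv_image)
    then have "wf {(\<zeta>, \<eta> :: omega1). \<zeta> < \<eta>}"
      by (rule wf_subset) (auto simp: less_omega1_def less_eq_omega1_def Rep_omega1_inject)
    then show ?thesis
      by (rule wf_induct_rule) (use that in auto)
  qed
  show "OFCLASS(omega1, wellorder_class)"
  proof (intro_classes)
    fix \<xi> \<eta> \<zeta> :: omega1
    show "\<xi> < \<eta> \<longleftrightarrow> \<xi> \<le> \<eta> \<and> \<not> \<eta> \<le> \<xi>"
      using asym refl by (auto simp: less_omega1_def)
    show "\<xi> \<le> \<xi>" by (rule refl)
    show "\<xi> \<le> \<eta> \<Longrightarrow> \<eta> \<le> \<zeta> \<Longrightarrow> \<xi> \<le> \<zeta>" by (rule trans)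
    show "\<xi> \<le> \<eta> \<Longrightarrow> \<eta> \<le> \<xi> \<Longrightarrow> \<xi> = \<eta>" by (rule asym)
    show "\<xi> \<le> \<eta> \<or> \<eta> \<le> \<xi>" by (rule total)
  next
    fix P :: "omega1 \<Rightarrow> bool" and \<xi>
    assume "\<And>\<eta>. (\<And>\<zeta>. \<zeta> < \<eta> \<Longrightarrow> P \<zeta>) \<Longrightarrow> P \<eta>"
    then show "P \<xi>" by (rule ind)
  qed
qed

end

definition osuc :: "omega1 \<Rightarrow> omega1" where
  "osuc \<xi> = (LEAST \<eta>. \<xi> < \<eta>)"

instantiation omega1 :: "{zero, one}"
begin
definition zero_omega1 :: omega1 where "0 = (LEAST \<xi> :: omega1. True)"
definition one_omega1 :: omega1 where "1 = osuc (0 :: omega1)"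
instance ..
end

definition limit_ordinal :: "omega1 \<Rightarrow> bool" where
  "limit_ordinal \<xi> \<longleftrightarrow> \<xi> \<noteq> 0 \<and> (\<nexists>\<zeta>. \<xi> = osuc \<zeta>)"

lemma countable_iff_ordLeq_natLeq:
  includes cardinal_syntax
  shows "countable A \<longleftrightarrow> |A| \<le>o natLeq"
proof -
  have "countable A \<longleftrightarrow> |A| \<le>o |UNIV :: nat set|"
    by (simp add: countable_def flip: card_of_ordLeq)
  then show ?thesis
    using card_of_nat ordIso_symmetric ordLeq_ordIso_trans by blast
qed

lemma omega1_no_greatest: "\<exists>\<eta>. (\<xi> :: omega1) < \<eta>"
proof -
  obtain b where "b \<in> Field (cardSuc natLeq)" "Rep_omega1 \<xi> \<noteq> b" "(Rep_omega1 \<xi>, b) \<in> cardSuc natLeq"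
    using infinite_Card_order_limit[OF Card_order_cardSuc_natLeq infinite_Field_cardSuc_natLeq Rep_omega1]
    by blast
  then have "\<xi> < Abs_omega1 b"
    by (auto simp: less_omega1_def less_eq_omega1_def Abs_omega1_inverse)
  then show ?thesis ..
qed

lemma countable_below_omega1:
  includes cardinal_syntax
  shows "countable {..<\<xi> :: omega1}"
proof -
  have "|underS (cardSuc natLeq) (Rep_omega1 \<xi>)| <o cardSuc natLeq"
    using card_of_underS[OF Card_order_cardSuc_natLeq Rep_omega1] .
  then have "countable (underS (cardSuc natLeq) (Rep_omega1 \<xi>))"
    by (simp add: countable_iff_ordLeq_natLeq cardSuc_ordLeq_ordLess natLeq_Card_order
        card_of_Card_order)
  moreover have "Rep_omega1 ` {..<\<xi>} \<subseteq> underS (cardSuc natLeq) (Rep_omega1 \<xi>)"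
    by (auto simp: underS_def less_omega1_def less_eq_omega1_def Rep_omega1_inject)
  ultimately have "countable (Rep_omega1 ` {..<\<xi>})"
    using countable_subset by blast
  then show ?thesis
    by (rule countable_image_inj_on) (simp add: inj_on_def Rep_omega1_inject)
qed

lemma uncountable_omega1:
  includes cardinal_syntax
  shows "uncountable (UNIV :: omega1 set)"
proof
  assume "countable (UNIV :: omega1 set)"
  then have "countable (Rep_omega1 ` UNIV)" by (rule countable_image)
  then have "countable (Field (cardSuc natLeq))"
    using type_definition.Rep_range[OF type_definition_omega1] by simp
  then have "|Field (cardSuc natLeq)| \<le>o natLeq"
    by (simp add: countable_iff_ordLeq_natLeq)
  then have "cardSuc natLeq \<le>o natLeq"
    using card_of_Field_ordIso[OF Card_order_cardSuc_natLeq]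
    by (meson ordIso_ordLeq_trans ordIso_symmetric)
  then show False
    using cardSuc_greater[OF natLeq_Card_order] not_ordLess_ordLeq by blast
qed

lemma less_osuc: "\<xi> < osuc \<xi>"
  unfolding osuc_def using omega1_no_greatest[of \<xi>] by (metis LeastI)

lemma osuc_inject: "osuc \<xi> = osuc \<eta> \<longleftrightarrow> \<xi> = \<eta>"
  by (metis less_osuc linorder_neqE not_less_Least osuc_def)

lemma zero_le_omega1: "0 \<le> (\<xi> :: omega1)"
  unfolding zero_omega1_def by (rule Least_le) simp

lemma osuc_neq_zero: "osuc \<xi> \<noteq> 0"
  by (metis less_osuc zero_le_omega1 not_le)


section \<open>Schreier families\<close>

text \<open>
  Here \<open>\<nat> = {1, 2, \<dots>}\<close>; accordingly every sequence below is a function on type \<open>nat\<close> whose value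
  at \<open>0\<close> is irrelevant.
\<close>

text \<open>The sequences \<open>(\<zeta>\<^sub>n)\<close> fixed for the limit ordinals: \<open>z \<xi> n\<close> is the \<open>n\<close>-th term of the one
  for \<open>\<xi>\<close>.\<close>

definition fundamental_sequences :: "(omega1 \<Rightarrow> nat \<Rightarrow> omega1) \<Rightarrow> bool" where
  "fundamental_sequences z \<longleftrightarrow>
    (\<forall>\<xi>. limit_ordinal \<xi> \<longrightarrow>
      strict_mono_on {1..} (z \<xi>) \<and>
      (\<forall>n\<ge>1. \<not> limit_ordinal (z \<xi> n)) \<and>
      (\<forall>n\<ge>1. z \<xi> n \<le> \<xi>) \<and> (\<forall>\<eta>. (\<forall>n\<ge>1. z \<xi> n \<le> \<eta>) \<longrightarrow> \<xi> \<le> \<eta>))"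

definition schreier_zero :: "nat set set" where
  "schreier_zero = {{n} | n. n \<ge> 1} \<union> {{}}"

text \<open>Finiteness is explicit because \<open>card\<close> of an infinite set is \<open>0\<close>.\<close>

definition schreier_one :: "nat set set" where
  "schreier_one = {F. finite F \<and> F \<noteq> {} \<and> F \<subseteq> {1..} \<and> card F \<le> Min F} \<union> {{}}"

text \<open>
  For a fixed choice \<open>z\<close> with \<^term>\<open>fundamental_sequences z\<close> this is the transfinite recursion of the
  Schreier families, see the four recursion equations below.
\<close>

inductive in_schreier :: "(omega1 \<Rightarrow> nat \<Rightarrow> omega1) \<Rightarrow> omega1 \<Rightarrow> nat set \<Rightarrow> bool" for z where
  zero: "F \<in> schreier_zero \<Longrightarrow> in_schreier z 0 F"
| one: "F \<in> schreier_one \<Longrightarrow> in_schreier z 1 F"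
| suc_empty: "1 \<le> \<zeta> \<Longrightarrow> in_schreier z (osuc \<zeta>) {}"
| suc: "1 \<le> \<zeta> \<Longrightarrow> n \<ge> 1 \<Longrightarrow>
    \<forall>k\<in>{1..n}. in_schreier z \<zeta> (G k) \<and> G k \<noteq> {} \<Longrightarrow>
    \<forall>k\<in>{1..<n}. Max (G k) < Min (G (Suc k)) \<Longrightarrow>
    (\<lambda>k. Min (G k)) ` {1..n} \<in> schreier_one \<Longrightarrow>
    in_schreier z (osuc \<zeta>) (\<Union>k\<in>{1..n}. G k)"
| limit: "limit_ordinal \<xi> \<Longrightarrow> n \<ge> 1 \<Longrightarrow> in_schreier z (z \<xi> n) F \<Longrightarrow> \<forall>m\<in>F. n \<le> m \<Longrightarrow>
    in_schreier z \<xi> F"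

definition schreier :: "(omega1 \<Rightarrow> nat \<Rightarrow> omega1) \<Rightarrow> omega1 \<Rightarrow> nat set set" where
  "schreier z \<xi> = {F. in_schreier z \<xi> F}"

lemma schreier_0: "schreier z 0 = schreier_zero"
  unfolding schreier_def
  by (auto intro: in_schreier.zero elim: in_schreier.cases
      simp: one_omega1_def osuc_neq_zero osuc_neq_zero[symmetric] limit_ordinal_def)

lemma osuc_neq_one: "1 \<le> \<zeta> \<Longrightarrow> osuc \<zeta> \<noteq> 1"
  using less_osuc[of 0] by (auto simp: one_omega1_def osuc_inject)

lemma schreier_1: "schreier z 1 = schreier_one"
proof -
  have "F \<in> schreier_one" if "in_schreier z 1 F" for F
    using that
    by cases (metis one_omega1_def osuc_neq_zero limit_ordinal_def osuc_neq_one)+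
  then show ?thesis
    by (auto simp: schreier_def intro: in_schreier.one)
qed

lemma schreier_osuc:
  assumes "1 \<le> \<zeta>"
  shows "schreier z (osuc \<zeta>) = {{}} \<union>
    {F. \<exists>n\<ge>1. \<exists>G. (\<forall>k\<in>{1..n}. G k \<in> schreier z \<zeta> \<and> G k \<noteq> {}) \<and>
      (\<forall>k\<in>{1..<n}. Max (G k) < Min (G (Suc k))) \<and>
      (\<lambda>k. Min (G k)) ` {1..n} \<in> schreier_one \<and> F = (\<Union>k\<in>{1..n}. G k)}"
    (is "_ = ?R")
proof -
  have fwd: "F \<in> ?R" if "in_schreier z (osuc \<zeta>) F" for F
    using that
  proof cases
    case (suc \<zeta>' n G)
    then show ?thesis
      unfolding osuc_inject schreier_def by blast
  qed (use assms osuc_neq_zero osuc_neq_one in \<open>auto simp: limit_ordinal_def\<close>)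
  have bwd: "in_schreier z (osuc \<zeta>) F" if "F \<in> ?R" for F
    using that assms in_schreier.suc_empty[of \<zeta> z] in_schreier.suc[of \<zeta> _ z]
    unfolding schreier_def by blast
  show ?thesis
  proof (rule set_eqI)
    fix F
    have "F \<in> schreier z (osuc \<zeta>) \<longleftrightarrow> in_schreier z (osuc \<zeta>) F"
      by (simp only: schreier_def mem_Collect_eq)
    with fwd[of F] bwd[of F] show "F \<in> schreier z (osuc \<zeta>) \<longleftrightarrow> F \<in> ?R"
      by argo
  qed
qed

lemma schreier_limit:
  assumes "limit_ordinal \<xi>"
  shows "schreier z \<xi> = (\<Union>n\<in>{1..}. {F \<in> schreier z (z \<xi> n). \<forall>m\<in>F. n \<le> m})"
proof -
  have "\<exists>n\<ge>1. in_schreier z (z \<xi> n) F \<and> (\<forall>m\<in>F. n \<le> m)" if "in_schreier z \<xi> F" for F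
    using that
  proof cases
    case (limit n)
    then show ?thesis by blast
  qed (use assms in \<open>auto simp: limit_ordinal_def one_omega1_def\<close>)
  then have "in_schreier z \<xi> F \<longleftrightarrow> (\<exists>n\<ge>1. in_schreier z (z \<xi> n) F \<and> (\<forall>m\<in>F. n \<le> m))" for F
    using in_schreier.limit[OF assms, of _ z F] by metis
  then show ?thesis
    by (simp add: schreier_def set_eq_iff Bex_def)
qed


section \<open>Banach spaces and operators over the scalar field\<close>

text \<open>
  The scalar field is a type \<open>'k\<close> of class \<^class>\<open>real_normed_field\<close>; by Gelfand--Mazur such a type
  is, up to isometric isomorphism, \<open>\<real>\<close> or \<open>\<complex>\<close>.  A Banach space over \<open>'k\<close> is a type of class
  \<^class>\<open>banach\<close> with a \<open>'k\<close>-scalar multiplication extending the real one, for which the norm is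
  homogeneous.
\<close>

locale banach_over = vector_space scale
  for scale :: "'k::real_normed_field \<Rightarrow> 'a::banach \<Rightarrow> 'a" +
  assumes scale_of_real: "scale (of_real r) x = r *\<^sub>R x"
    and norm_scale: "norm (scale c x) = norm c * norm x"

definition continuous_operators ::
    "('k::real_normed_field \<Rightarrow> 'a::real_normed_vector \<Rightarrow> 'a) \<Rightarrow>
     ('k \<Rightarrow> 'b::real_normed_vector \<Rightarrow> 'b) \<Rightarrow> ('a \<Rightarrow> 'b) set" where
  "continuous_operators sX sY = {T. Vector_Spaces.linear sX sY T \<and> continuous_on UNIV T}"

definition weakly_null ::
    "('k::real_normed_field \<Rightarrow> 'a::real_normed_vector \<Rightarrow> 'a) \<Rightarrow> (nat \<Rightarrow> 'a) \<Rightarrow> bool" where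
  "weakly_null sX x \<longleftrightarrow> (\<forall>f \<in> continuous_operators sX ((*) :: 'k \<Rightarrow> 'k \<Rightarrow> 'k). (\<lambda>n. f (x n)) \<longlonglongrightarrow> 0)"

definition completely_continuous ::
    "('k::real_normed_field \<Rightarrow> 'a::real_normed_vector \<Rightarrow> 'a) \<Rightarrow>
     ('k \<Rightarrow> 'b::real_normed_vector \<Rightarrow> 'b) \<Rightarrow> ('a \<Rightarrow> 'b) set" where
  "completely_continuous sX sY =
    {T \<in> continuous_operators sX sY. \<forall>x. weakly_null sX x \<longrightarrow> (\<lambda>n. norm (T (x n))) \<longlonglongrightarrow> 0}"


section \<open>The classes \<open>WD\<close>\<close>

definition supp :: "(nat \<Rightarrow> 'k::zero) \<Rightarrow> nat set" where
  "supp \<alpha> = {k. \<alpha> k \<noteq> 0}"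

definition schreier_coeffs :: "(omega1 \<Rightarrow> nat \<Rightarrow> omega1) \<Rightarrow> omega1 \<Rightarrow> (nat \<Rightarrow> 'k::zero) set" where
  "schreier_coeffs z \<xi> = {\<alpha>. finite (supp \<alpha>) \<and> supp \<alpha> \<in> schreier z \<xi>}"

text \<open>The \<open>\<ell>\<^sub>p\<close>-norm of a finitely supported sequence, for \<open>1 \<le> p \<le> \<infinity>\<close>.\<close>

definition lp_norm :: "ennreal \<Rightarrow> (nat \<Rightarrow> 'k::real_normed_field) \<Rightarrow> real" where
  "lp_norm p \<alpha> =
    (if p = \<infinity> then (SUP k. norm (\<alpha> k))
     else (\<Sum>k\<in>supp \<alpha>. norm (\<alpha> k) powr enn2real p) powr (1 / enn2real p))"

text \<open>A subsequence is given by a strictly increasing \<open>r\<close>; then \<open>r k \<ge> 1\<close> for \<open>k \<ge> 1\<close>, and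
  \<open>r 0\<close> plays no role, as \<open>0\<close> lies in no member of a Schreier family.\<close>

definition WD_const ::
    "('k::real_normed_field \<Rightarrow> 'a::real_normed_vector \<Rightarrow> 'a) \<Rightarrow>
     ('k \<Rightarrow> 'b::real_normed_vector \<Rightarrow> 'b) \<Rightarrow> (omega1 \<Rightarrow> nat \<Rightarrow> omega1) \<Rightarrow>
     ennreal \<Rightarrow> real \<Rightarrow> omega1 \<Rightarrow> ('a \<Rightarrow> 'b) set" where
  "WD_const sX sY z p C \<xi> =
    {T \<in> continuous_operators sX sY.
      \<forall>\<epsilon>>0. \<forall>x. (\<forall>n\<ge>1. norm (x n) = 1) \<and> weakly_null sX x \<longrightarrow>
        (\<exists>r. strict_mono r \<and>
          (\<forall>\<alpha>\<in>schreier_coeffs z \<xi>.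
            norm (\<Sum>k\<in>supp \<alpha>. sY (\<alpha> k) (T (x (r k)))) \<le> (C + \<epsilon>) * lp_norm p \<alpha>))}"

definition WD ::
    "('k::real_normed_field \<Rightarrow> 'a::real_normed_vector \<Rightarrow> 'a) \<Rightarrow>
     ('k \<Rightarrow> 'b::real_normed_vector \<Rightarrow> 'b) \<Rightarrow> (omega1 \<Rightarrow> nat \<Rightarrow> omega1) \<Rightarrow>
     ennreal \<Rightarrow> ennreal \<Rightarrow> omega1 \<Rightarrow> ('a \<Rightarrow> 'b) set" where
  "WD sX sY z p C \<xi> =
    (if C = \<infinity> then (\<Union>c\<in>{0..}. WD_const sX sY z p c \<xi>) else WD_const sX sY z p (enn2real C) \<xi>)"

end

theory Submission
  imports Defs
begin

text \<open>
  If \<open>T\<close> is completely continuous and \<open>(x\<^sub>n)\<close> is weakly null, then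
  \<open>\<parallel>T x\<^sub>n\<parallel> \<longlonglongrightarrow> 0\<close>, so some subsequence satisfies \<open>\<parallel>T x\<^bsub>r k\<^esub>\<parallel> \<le> \<epsilon> / 2\<^bsup>k+1\<^esup>\<close>
  (\<open>null_sequence_dominated_subseq\<close>).  These bounds sum to at most \<open>\<epsilon>\<close>, and every coefficient
  is bounded by the \<open>\<ell>\<^sub>p\<close>-norm (\<open>norm_le_lp_norm\<close>), so for
  finitely supported \<open>\<alpha>\<close> the triangle inequality gives
  \<open>\<parallel>\<Sum>\<alpha>\<^sub>k T x\<^bsub>r k\<^esub>\<parallel> \<le> \<epsilon> \<parallel>\<alpha>\<parallel>\<^sub>p\<close>.  This is the defining estimate with the constant \<open>0\<close>, hence
  with every constant \<open>C \<ge> 0\<close>.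
\<close>

text \<open>
  One term of a sum of nonnegative terms is at most the sum; finiteness of the support makes
  the supremum in the case \<open>p = \<infinity>\<close> a genuine upper bound.
\<close>

lemma norm_le_lp_norm:
  fixes \<alpha> :: "nat \<Rightarrow> 'k::real_normed_field"
  assumes fin: "finite (supp \<alpha>)" and p: "1 \<le> p"
  shows "norm (\<alpha> k) \<le> lp_norm p \<alpha>"
proof (cases "p = \<infinity>")
  case True
  have "range (\<lambda>k. norm (\<alpha> k)) \<subseteq> insert 0 ((\<lambda>k. norm (\<alpha> k)) ` supp \<alpha>)"
    by (auto simp: supp_def)
  then have "finite (range (\<lambda>k. norm (\<alpha> k)))"
    using fin by (meson finite_imageI finite_insert finite_subset)
  then have "bdd_above (range (\<lambda>k. norm (\<alpha> k)))"
    by (rule bdd_above_finite)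
  then show ?thesis
    using True cSUP_upper[of k UNIV "\<lambda>k. norm (\<alpha> k)"] by (simp add: lp_norm_def)
next
  case False
  define q where "q = enn2real p"
  have "q \<ge> 1"
    using enn2real_mono[OF p] False by (simp add: q_def top.not_eq_extremum)
  show ?thesis
  proof (cases "k \<in> supp \<alpha>")
    case True
    have "norm (\<alpha> k) = (norm (\<alpha> k) powr q) powr (1 / q)"
      using \<open>q \<ge> 1\<close> by (simp add: powr_powr)
    also have "\<dots> \<le> (\<Sum>k\<in>supp \<alpha>. norm (\<alpha> k) powr q) powr (1 / q)"
      using \<open>q \<ge> 1\<close> fin True by (intro powr_mono2 member_le_sum) auto
    finally show ?thesis
      using \<open>p \<noteq> \<infinity>\<close> by (simp add: lp_norm_def q_def)
  qed (use False in \<open>simp add: supp_def lp_norm_def\<close>)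
qed

lemma null_sequence_dominated_subseq:
  fixes a b :: "nat \<Rightarrow> real"
  assumes "a \<longlonglongrightarrow> 0" and "\<And>k. b k > 0"
  obtains r :: "nat \<Rightarrow> nat" where "strict_mono r" "\<And>k. a (r k) \<le> b k"
proof -
  have "\<exists>N. \<forall>n\<ge>N. a n < b k" for k
    using order_tendstoD(2)[OF assms(1) assms(2)[of k]] by (simp add: eventually_sequentially)
  then obtain N where N: "\<And>k n. n \<ge> N k \<Longrightarrow> a n < b k"
    by metis
  \<comment> \<open>The partial sums make \<open>r k \<ge> N k\<close> and monotonicity hold at once, without recursion.\<close>
  define r where "r k = k + (\<Sum>i\<le>k. N i)" for k
  have "strict_mono r"
    by (simp add: strict_mono_Suc_iff r_def)
  moreover have "N k \<le> r k" for k
    using member_le_sum[of k "{..k}" N] by (simp add: r_def)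
  ultimately show thesis
    using that N less_imp_le by blast
qed

lemma sum_half_powers_le_1: "finite F \<Longrightarrow> (\<Sum>k\<in>F. (1/2::real) ^ Suc k) \<le> 1"
  using power_half_series by (metis sum_le_suminf sums_iff zero_le_divide_1_iff zero_le_numeral
      zero_le_power)

text \<open>
  The weights \<open>1 / 2\<^bsup>k+1\<^esup>\<close> have total mass \<open>1\<close>, so the bound is independent of how many terms
  are added.
\<close>

lemma (in banach_over) norm_sum_scale_le:
  assumes "finite F" and "0 \<le> \<epsilon>" and "\<And>k. k \<in> F \<Longrightarrow> norm (c k) \<le> M"
    and "\<And>k. k \<in> F \<Longrightarrow> norm (y k) \<le> \<epsilon> * (1/2) ^ Suc k" and "0 \<le> M"
  shows "norm (\<Sum>k\<in>F. scale (c k) (y k)) \<le> \<epsilon> * M"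
proof -
  have "norm (\<Sum>k\<in>F. scale (c k) (y k)) \<le> (\<Sum>k\<in>F. M * (\<epsilon> * (1/2) ^ Suc k))"
    using assms by (intro sum_norm_le) (simp only: norm_scale mult_mono norm_ge_zero)
  also have "\<dots> = \<epsilon> * M * (\<Sum>k\<in>F. (1/2) ^ Suc k)"
    by (simp only: sum_distrib_left mult_ac)
  also have "\<dots> \<le> \<epsilon> * M"
    using sum_half_powers_le_1[OF assms(1)] assms(2,5) by (intro mult_left_le) auto
  finally show ?thesis .
qed

lemma completely_continuous_subset_WD_const:
  fixes sX :: "'k::real_normed_field \<Rightarrow> 'a::banach \<Rightarrow> 'a"
    and sY :: "'k \<Rightarrow> 'b::banach \<Rightarrow> 'b"
  assumes sY: "banach_over sY" and p: "1 \<le> p" and "0 \<le> C"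
  shows "completely_continuous sX sY \<subseteq> WD_const sX sY z p C \<xi>"
proof
  fix T assume T: "T \<in> completely_continuous sX sY"
  have "\<exists>r. strict_mono r \<and> (\<forall>\<alpha>\<in>schreier_coeffs z \<xi>.
          norm (\<Sum>k\<in>supp \<alpha>. sY (\<alpha> k) (T (x (r k)))) \<le> (C + \<epsilon>) * lp_norm p \<alpha>)"
    if "\<epsilon> > 0" "weakly_null sX x" for \<epsilon> x
  proof -
    have "(\<lambda>n. norm (T (x n))) \<longlonglongrightarrow> 0"
      using T that by (auto simp: completely_continuous_def)
    then obtain r where r: "strict_mono r" "\<And>k. norm (T (x (r k))) \<le> \<epsilon> * (1/2) ^ Suc k"
      by (rule null_sequence_dominated_subseq[of _ "\<lambda>k. \<epsilon> * (1/2) ^ Suc k"])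
        (use \<open>\<epsilon> > 0\<close> in auto)
    have "norm (\<Sum>k\<in>supp \<alpha>. sY (\<alpha> k) (T (x (r k)))) \<le> (C + \<epsilon>) * lp_norm p \<alpha>"
      if "\<alpha> \<in> schreier_coeffs z \<xi>" for \<alpha>
    proof -
      have fin: "finite (supp \<alpha>)"
        using that by (simp add: schreier_coeffs_def)
      note le = norm_le_lp_norm[OF fin p]
      have nonneg: "0 \<le> lp_norm p \<alpha>"
        using le[of 0] norm_ge_zero order_trans by blast
      have "norm (\<Sum>k\<in>supp \<alpha>. sY (\<alpha> k) (T (x (r k)))) \<le> \<epsilon> * lp_norm p \<alpha>"
        using \<open>\<epsilon> > 0\<close> by (intro banach_over.norm_sum_scale_le[OF sY fin] le r nonneg) simp
      also have "\<dots> \<le> (C + \<epsilon>) * lp_norm p \<alpha>"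
        using \<open>0 \<le> C\<close> nonneg by (intro mult_right_mono) auto
      finally show ?thesis .
    qed
    then show ?thesis
      using r(1) by blast
  qed
  then show "T \<in> WD_const sX sY z p C \<xi>"
    using T by (simp add: WD_const_def completely_continuous_def)
qed

theorem proposition2p5:
  fixes sX :: "'k::real_normed_field \<Rightarrow> 'a::banach \<Rightarrow> 'a"
    and sY :: "'k \<Rightarrow> 'b::banach \<Rightarrow> 'b"
    and z :: "omega1 \<Rightarrow> nat \<Rightarrow> omega1"
    and p C :: ennreal
    and \<xi> :: omega1
  assumes "banach_over sX" and "banach_over sY"
    and "fundamental_sequences z"
    and "1 \<le> p" and "0 \<le> C" and "1 \<le> \<xi>"
  shows "completely_continuous sX sY \<subseteq> WD sX sY z p C \<xi>"
proof -
  have *: "completely_continuous sX sY \<subseteq> WD_const sX sY z p c \<xi>" if "0 \<le> c" for c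
    using completely_continuous_subset_WD_const assms(2,4) that by blast
  show ?thesis
  proof (cases "C = \<infinity>")
    case True
    then show ?thesis
      using *[of 0] by (auto simp: WD_def)
  next
    case False
    then show ?thesis
      using *[of "enn2real C"] by (simp add: WD_def)
  qed
qed

end
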